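(* Let $k\ge1$ and let $\lambda\in\mathcal P^k_{\mathrm{sq}}$ with $\tau_k\lambda=\lambda$. There is an isomorphism of trees $\psi:\mathbf T_\lambda\cong\mathbf T$ such that $\psi(\lambda)=v_0$ and such that, if $\nu\in\mathcal P^\ell(\lambda)$, then the vertex $\psi(\nu)$ has label $(\nu_\ell+1,\ \ell+2-\nu_1)$ if $\nu\in\mathcal P^\ell_{\mathrm d}(\lambda)$, and label $(\nu_\ell+1)$ if $\nu\in\mathcal P^\ell_\tau(\lambda)$.
   Context: A partition with $n$ parts is a sequence $\lambda=(\lambda_1\ge\lambda_2\ge\cdots\ge\lambda_n>0)$ of positive integers. Write $\lambda\setminus\{\lambda_n\}=(\lambda_1\ge\cdots\ge\lambda_{n-1})$ and, for $0<j\le\lambda_n$, $(\lambda:j)=(\lambda_1\ge\cdots\ge\lambda_n\ge j)$. For positive integers $n,k$, $\mathcal P^{n,k}$ is the set of partitions with exactly $n$ parts and $\lambda_1\le k$; $\tau_k:\mathcal P^{n,k}\to\mathcal P^{n,k}$ is the involution $\tau_k(\lambda_1\ge\cdots\ge\lambda_n)=(k+1-\lambda_n\ge\cdots\ge k+1-\lambda_1)$. Set $\mathcal P^k=\mathcal P^{k,k}$ and $\mathcal P^k_{\mathrm{sq}}=\{\lambda\in\mathcal P^k:\lambda_1=k,\ \lambda_k=1\}$. For $\lambda\in\mathcal P^k$ define $\mathcal P^\ell(\lambda)\subset\mathcal P^\ell$ for $\ell\ge k$ inductively: $\mathcal P^k(\lambda)=\{\lambda\}\cup\{\tau_k\lambda\}$,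 and for $\ell>k$, $\mathcal P^\ell(\lambda)=\mathcal P^\ell_{\mathrm d}(\lambda)\cup\mathcal P^\ell_\tau(\lambda)$, where $\mathcal P^\ell_{\mathrm d}(\lambda)=\{\mu\in\mathcal P^\ell:\mu\setminus\{\mu_\ell\}\in\mathcal P^{\ell-1}(\lambda)\}$ and $\mathcal P^\ell_\tau(\lambda)=\tau_\ell\,\mathcal P^\ell_{\mathrm d}(\lambda)$. For $\ell=k$ the sets $\mathcal P^k_{\mathrm d}(\lambda)$ and $\mathcal P^k_\tau(\lambda)$ are read with $\mathcal P^{k-1}(\lambda)=\emptyset$, i.e. as empty. For $\mu\in\mathcal P^\ell$ set $\mathbf d(\mu)=\{(\mu:j):1\le j\le\mu_\ell\}\cup\{\tau_{\ell+1}(\mu:1)\}\subset\mathcal P^{\ell+1}$. For $\lambda\in\mathcal P^k_{\mathrm{sq}}$ with $\tau_k\lambda=\lambda$, $\mathbf T_\lambda$ is the tree, rooted at $\lambda$, with vertex set $\bigsqcup_{\ell\ge k}\mathcal P^\ell(\lambda)$, in which $\mu,\nu$ are joined by an edge precisely if $\nu\in\mathbf d(\mu)$ or $\mu\in\mathbf d(\nu)$. $\mathbf T$ is the rooted tree whose vertices are labeled either by a pair of integers or by a single integer, generated as follows. The root $v_0$ has label $(2,2)$; it has two descendants (children), labeled $(2,3)$ and $(3)$. A vertex labeled $(i,j)$ has $i$ descendants: the first $i-1$ are labeled $(p,j+1)$ for $2\le p\le i$ (one each), and the last is labeled $(j+1)$. A vertex labeled $(r)$ has $r$ descendants: the first $r-1$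 are labeled $(p,3)$ for $2\le p\le r$ (one each), and the last is labeled $(3)$.
   Formalization: The single label is claimed only for ν in P_τ not also in P_d; the two sets can overlap (for λ=(1), ℓ=3, (2,2,2) lies in both), where the literal statement would demand two different labels; there the pair label holds. *)

theory Defs
  imports Main
begin

section \<open>Partitions\<close>

text \<open>A partition is the list of its parts in weakly decreasing order, so
  \<open>\<lambda>\<^sub>1\<close> is \<open>hd\<close>, the last part is \<open>last\<close>, removing the last part is \<open>butlast\<close>
  and \<open>(\<lambda> : j)\<close> is \<open>lam @ [j]\<close>.\<close>

definition is_partition :: "nat list \<Rightarrow> bool" where
  "is_partition lam \<longleftrightarrow> sorted_wrt (\<ge>) lam \<and> (\<forall>x\<in>set lam. 0 < x)"

text \<open>\<open>\<P>\<^bsup>n,k\<^esup>\<close>; used only for \<open>n \<ge> 1\<close> (\<open>hd []\<close> is unspecified).\<close>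

definition Pnk :: "nat \<Rightarrow> nat \<Rightarrow> nat list set" where
  "Pnk n k = {lam. is_partition lam \<and> length lam = n \<and> hd lam \<le> k}"

abbreviation Pk :: "nat \<Rightarrow> nat list set" where
  "Pk k \<equiv> Pnk k k"

text \<open>The subtraction does not truncate on \<open>Pnk n k\<close>, where all parts are at most \<open>k\<close>.\<close>

definition tau :: "nat \<Rightarrow> nat list \<Rightarrow> nat list" where
  "tau k lam = map (\<lambda>x. k + 1 - x) (rev lam)"

definition Psq :: "nat \<Rightarrow> nat list set" where
  "Psq k = {lam \<in> Pk k. hd lam = k \<and> last lam = 1}"

section \<open>The sets \<open>\<P>\<^bsup>l\<^esup>(\<lambda>)\<close>\<close>

definition extend :: "nat \<Rightarrow> nat list set \<Rightarrow> nat list set" where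
  "extend l S = {mu \<in> Pk l. butlast mu \<in> S}"

text \<open>For \<open>k \<ge> 1\<close> and \<open>lam \<in> Pk k\<close>. The sets are empty for \<open>l < k\<close>; this implements the
  convention \<open>\<P>\<^bsup>k-1\<^esup>(\<lambda>) = \<emptyset>\<close>, which makes \<open>Pd k lam k\<close> and \<open>Ptau k lam k\<close> empty.\<close>

primrec Plam :: "nat \<Rightarrow> nat list \<Rightarrow> nat \<Rightarrow> nat list set" where
  "Plam k lam 0 = {}"
| "Plam k lam (Suc l) =
     (if Suc l < k then {}
      else if Suc l = k then {lam} \<union> {tau k lam}
      else extend (Suc l) (Plam k lam l) \<union> tau (Suc l) ` extend (Suc l) (Plam k lam l))"

definition Pd :: "nat \<Rightarrow> nat list \<Rightarrow> nat \<Rightarrow> nat list set" where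
  "Pd k lam l = extend l (Plam k lam (l - 1))"

definition Ptau :: "nat \<Rightarrow> nat list \<Rightarrow> nat \<Rightarrow> nat list set" where
  "Ptau k lam l = tau l ` Pd k lam l"

lemma Plam_initial: "1 \<le> k \<Longrightarrow> Plam k lam k = {lam} \<union> {tau k lam}"
  by (cases k) auto

lemma Plam_step: "k < l \<Longrightarrow> Plam k lam l = Pd k lam l \<union> Ptau k lam l"
  by (cases l) (auto simp: Pd_def Ptau_def)

lemma Pd_Ptau_initial:
  assumes "1 \<le> k"
  shows "Pd k lam k = {}" "Ptau k lam k = {}"
proof -
  have "Plam k lam l = {}" if "l < k" for l
    using that by (cases l) auto
  then show "Pd k lam k = {}" "Ptau k lam k = {}"
    using assms by (auto simp: Pd_def Ptau_def extend_def)
qed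

text \<open>The two sets need not be disjoint for \<open>l > k\<close>: for example, \<open>(2,2,2)\<close> lies in both
  when \<open>\<lambda> = (1)\<close> and \<open>l = 3\<close>. Since a vertex has only one label, the label rule for \<open>Ptau\<close> has to be
  restricted to \<open>Ptau k lam l - Pd k lam l\<close>.\<close>

lemma Pd_Ptau_overlap: "[2,2,2] \<in> Pd 1 [1] 3 \<inter> Ptau 1 [1] 3"
proof -
  have "[1,1] \<in> Pd 1 [1] 2"
    by (simp add: Pd_def extend_def Pnk_def is_partition_def)
  moreover have "tau 2 [1,1] = [2,2]"
    by (simp add: tau_def)
  ultimately have "[2,2] \<in> Ptau 1 [1] 2"
    unfolding Ptau_def by (metis imageI)
  then have "[2,2] \<in> Plam 1 [1] 2"
    by (simp add: Plam_step)
  then have "[2,2,2] \<in> Pd 1 [1] 3"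
    by (simp add: Pd_def extend_def Pnk_def is_partition_def)
  moreover have "tau 3 [2,2,2] = [2,2,2]"
    by (simp add: tau_def)
  ultimately show ?thesis
    unfolding Ptau_def by (metis IntI imageI)
qed

section \<open>The tree \<open>T\<^sub>\<lambda>\<close>\<close>

definition dset :: "nat list \<Rightarrow> nat list set" where
  "dset mu = {mu @ [j] | j. 1 \<le> j \<and> j \<le> last mu} \<union> {tau (length mu + 1) (mu @ [1])}"

text \<open>The union over \<open>l\<close> is disjoint, since members of \<open>Plam k lam l\<close> have length \<open>l\<close>.\<close>

definition Tlam_verts :: "nat \<Rightarrow> nat list \<Rightarrow> nat list set" where
  "Tlam_verts k lam = (\<Union>l\<in>{k..}. Plam k lam l)"

definition Tlam_adj :: "nat list \<Rightarrow> nat list \<Rightarrow> bool" where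
  "Tlam_adj mu nu \<longleftrightarrow> nu \<in> dset mu \<or> mu \<in> dset nu"

section \<open>The labeled tree \<open>T\<close>\<close>

datatype label = PairLabel int int | SingleLabel int

primrec descendant_labels :: "label \<Rightarrow> label list" where
  "descendant_labels (PairLabel i j) = map (\<lambda>p. PairLabel p (j + 1)) [2..i] @ [SingleLabel (j + 1)]"
| "descendant_labels (SingleLabel r) = map (\<lambda>p. PairLabel p 3) [2..r] @ [SingleLabel 3]"

text \<open>A vertex is the address of a node, read from the node up to the root: \<open>[]\<close> is the
  root and \<open>c # w\<close> is the descendant of \<open>w\<close> with index \<open>c\<close>, counting from \<open>0\<close>.\<close>

primrec T_label :: "nat list \<Rightarrow> label" where
  "T_label [] = PairLabel 2 2"
| "T_label (c # w) = descendant_labels (T_label w) ! c"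

inductive_set T_verts :: "nat list set" where
  root: "[] \<in> T_verts"
| descendant: "w \<in> T_verts \<Longrightarrow> c < length (descendant_labels (T_label w)) \<Longrightarrow> c # w \<in> T_verts"

definition T_adj :: "nat list \<Rightarrow> nat list \<Rightarrow> bool" where
  "T_adj v w \<longleftrightarrow> (\<exists>c. v = c # w) \<or> (\<exists>c. w = c # v)"

abbreviation T_root :: "nat list" where
  "T_root \<equiv> []"

section \<open>Isomorphism\<close>

definition graph_iso ::
  "'a set \<Rightarrow> ('a \<Rightarrow> 'a \<Rightarrow> bool) \<Rightarrow> 'b set \<Rightarrow> ('b \<Rightarrow> 'b \<Rightarrow> bool) \<Rightarrow> ('a \<Rightarrow> 'b) \<Rightarrow> bool" where
  "graph_iso V E V' E' f \<longleftrightarrow>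
     bij_betw f V V' \<and> (\<forall>x\<in>V. \<forall>y\<in>V. E x y \<longleftrightarrow> E' (f x) (f y))"

end

theory Submission
  imports Defs
begin

text \<open>The tree \<open>\<^bold>T\<close> is generated from its root by a rule that reads the labels of the
  descendants of a vertex off the label of that vertex. So the theorem follows once
  \<open>\<^bold>T\<^sub>\<lambda>\<close> is known to be generated by the same rule: the descendants of \<open>\<mu> \<in> \<P>\<^sup>l(\<lambda>)\<close> are the
  elements of \<open>\<^bold>d(\<mu>)\<close>, each vertex other than \<open>\<lambda>\<close> lies in \<open>\<^bold>d(\<mu>)\<close> for exactly one vertex \<open>\<mu>\<close>,
  and the labels of the elements of \<open>\<^bold>d(\<mu>)\<close> depend on that of
  \<open>\<mu>\<close> by the rule of \<open>\<^bold>T\<close> (\<open>part_label_children\<close>). The isomorphism is the inverse of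
  the map that sends the address of a vertex of \<open>\<^bold>T\<close> to the partition reached by following that
  address in \<open>\<^bold>T\<^sub>\<lambda>\<close> (\<open>node_bij\<close>, \<open>T_label_node\<close>, \<open>T_adj_node\<close>).

  Uniqueness of the parent is a matter of the first part. An element \<open>(\<mu> : j)\<close> of
  \<open>\<P>\<^bsup>l+1\<^esup>\<close> has first part \<open>\<mu>\<^sub>1 \<le> l\<close>, while \<open>\<tau>(\<mu> : 1)\<close> has first part \<open>l + 1\<close>; within each
  kind, \<open>\<mu>\<close> is recovered by deleting the last part, after applying the involution \<open>\<tau>\<close> in the
  second case (\<open>dset_parent_unique\<close>).

  Existence of the parent is where the hypotheses on \<open>\<lambda>\<close> enter. An element of \<open>\<P>\<^sub>\<tau>\<close> is \<open>\<tau>(\<mu> : j)\<close>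
  with any \<open>j\<close>, and for \<open>j \<ge> 2\<close> it has to be found among the elements of \<open>\<P>\<^sub>d\<close>. Deleting
  the last part of \<open>\<tau>\<nu>\<close> amounts to deleting the first row and the first column of
  the diagram of \<open>\<nu>\<close> and then applying \<open>\<tau>\<close>, so it suffices that
  \<open>\<P>\<^sup>l(\<lambda>)\<close> is carried into \<open>\<P>\<^bsup>l-1\<^esup>(\<lambda>)\<close> by this deletion, as far as
  the last part of \<open>\<nu>\<close> is at least 2 (\<open>drop_hook_Plam\<close>). This holds by induction on \<open>l\<close>; at \<open>l = k\<close> there
  is nothing to show because \<open>\<lambda> = \<tau>\<lambda>\<close> has last part 1.

  Consequently \<open>\<P>\<^sub>\<tau> - \<P>\<^sub>d\<close> consists of the partitions \<open>\<tau>(\<mu> : 1)\<close>, whose first part is as large as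
  possible. For them \<open>l + 2 - \<nu>\<^sub>1 = 2\<close>, which is why a single integer
  suffices as a label: \<open>(r)\<close> has the descendants of \<open>(r, 2)\<close>.\<close>

section \<open>Trees generated by the rule for T\<close>

primrec node :: "('a \<Rightarrow> 'a list) \<Rightarrow> 'a \<Rightarrow> nat list \<Rightarrow> 'a" where
  "node ch r [] = r"
| "node ch r (c # w) = ch (node ch r w) ! c"

text \<open>The function \<open>rank\<close> guarantees that each vertex is reached from the root after finitely many
  steps.\<close>

locale generated_tree =
  fixes r :: 'a and V :: "'a set" and lab :: "'a \<Rightarrow> label" and ch :: "'a \<Rightarrow> 'a list"
    and rank :: "'a \<Rightarrow> nat"
  assumes root_in: "r \<in> V"
    and root_label: "lab r = PairLabel 2 2"
    and labels: "x \<in> V \<Longrightarrow> map lab (ch x) = descendant_labels (lab x)"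
    and closed: "x \<in> V \<Longrightarrow> set (ch x) \<subseteq> V"
    and distinct_ch: "x \<in> V \<Longrightarrow> distinct (ch x)"
    and root_no_child: "x \<in> V \<Longrightarrow> r \<notin> set (ch x)"
    and parent_unique: "x \<in> V \<Longrightarrow> y \<in> V \<Longrightarrow> z \<in> set (ch x) \<Longrightarrow> z \<in> set (ch y) \<Longrightarrow> x = y"
    and parent_exists: "x \<in> V \<Longrightarrow> x \<noteq> r \<Longrightarrow> \<exists>y\<in>V. x \<in> set (ch y) \<and> rank y < rank x"
begin

abbreviation nd :: "nat list \<Rightarrow> 'a" where
  "nd \<equiv> node ch r"

lemma node_T_verts:
  assumes "w \<in> T_verts"
  shows "nd w \<in> V \<and> T_label w = lab (nd w)"
  using assms
proof (induction rule: T_verts.induct)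
  case root
  then show ?case using root_in root_label by simp
next
  case (descendant w c)
  have eq: "descendant_labels (T_label w) = map lab (ch (nd w))"
    using descendant.IH labels by simp
  then have c: "c < length (ch (nd w))"
    using descendant.hyps(2) by simp
  then have "ch (nd w) ! c \<in> V"
    using closed descendant.IH nth_mem by blast
  then show ?case
    using c eq by simp
qed

lemma T_label_node: "w \<in> T_verts \<Longrightarrow> T_label w = lab (nd w)"
  using node_T_verts by blast

lemma node_Cons_child:
  assumes "c # w \<in> T_verts"
  shows "w \<in> T_verts" "nd w \<in> V" "c < length (ch (nd w))" "nd (c # w) \<in> set (ch (nd w))"
proof -
  have w: "w \<in> T_verts" "c < length (descendant_labels (T_label w))"
    using assms by (auto elim: T_verts.cases)
  have nw: "nd w \<in> V" "T_label w = lab (nd w)"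
    using node_T_verts[OF w(1)] by auto
  have "c < length (map lab (ch (nd w)))"
    using w(2) nw labels by simp
  then show "w \<in> T_verts" "nd w \<in> V" "c < length (ch (nd w))" "nd (c # w) \<in> set (ch (nd w))"
    using w nw by auto
qed

text \<open>A nonroot address names a child of a vertex, so its last step can be undone because each
  vertex has at most one parent.\<close>

lemma node_inj:
  assumes "v \<in> T_verts" "w \<in> T_verts" "nd v = nd w"
  shows "v = w"
  using assms
proof (induction v arbitrary: w rule: list.induct)
  case Nil
  show ?case
  proof (cases w)
    case (Cons d u)
    then show ?thesis
      using Nil.prems node_Cons_child[of d u] root_no_child[of "nd u"] by simp
  qed simp
next
  case (Cons c v)
  note v = node_Cons_child[OF Cons.prems(1)]
  obtain d u where w: "w = d # u"
    using Cons.prems(3) v(4) root_no_child[OF v(2)] by (cases w) auto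
  note u = node_Cons_child[OF Cons.prems(2)[unfolded w]]
  have "nd v = nd u"
    using parent_unique[OF v(2) u(2) v(4)] u(4) Cons.prems(3) w by simp
  then have "v = u"
    using Cons.IH v(1) u(1) by blast
  then show ?case
    using Cons.prems(3) w v(3) u(3) distinct_ch[OF v(2)] by (simp add: nth_eq_iff_index_eq)
qed

lemma node_surj:
  assumes "x \<in> V"
  shows "x \<in> nd ` T_verts"
  using assms
proof (induction "rank x" arbitrary: x rule: less_induct)
  case less
  show ?case
  proof (cases "x = r")
    case True
    then show ?thesis using T_verts.root by (metis image_eqI node.simps(1))
  next
    case False
    then obtain y where y: "y \<in> V" "x \<in> set (ch y)" "rank y < rank x"
      using parent_exists less.prems by blast
    then obtain w where w: "w \<in> T_verts" "y = nd w"
      using less.hyps by blast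
    obtain c where c: "c < length (ch y)" "x = ch y ! c"
      using y(2) by (metis in_set_conv_nth)
    have "c < length (descendant_labels (T_label w))"
      using c(1) w T_label_node labels[OF y(1)] by (metis length_map)
    then have "c # w \<in> T_verts"
      using w(1) by (rule T_verts.descendant[rotated])
    then show ?thesis
      using c w(2) by (metis image_eqI node.simps(2))
  qed
qed

lemma node_bij: "bij_betw nd T_verts V"
  using node_inj node_surj node_T_verts by (auto simp: bij_betw_def inj_on_def)

lemma Cons_iff_child:
  assumes "v \<in> T_verts" "w \<in> T_verts"
  shows "(\<exists>c. v = c # w) \<longleftrightarrow> nd v \<in> set (ch (nd w))"
proof
  assume "\<exists>c. v = c # w"
  then show "nd v \<in> set (ch (nd w))"
    using node_Cons_child(4) assms(1) by blast
next
  assume child: "nd v \<in> set (ch (nd w))"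
  have nw: "nd w \<in> V"
    using node_T_verts assms(2) by blast
  obtain c u where v: "v = c # u"
    using child root_no_child[OF nw] by (cases v) auto
  note u = node_Cons_child[OF assms(1)[unfolded v]]
  have "nd u = nd w"
    using parent_unique[OF u(2) nw u(4)] child v by simp
  then show "\<exists>c. v = c # w"
    using node_inj[OF u(1) assms(2)] v by blast
qed

lemma T_adj_node:
  assumes "v \<in> T_verts" "w \<in> T_verts"
  shows "T_adj v w \<longleftrightarrow> nd w \<in> set (ch (nd v)) \<or> nd v \<in> set (ch (nd w))"
  unfolding T_adj_def using Cons_iff_child assms by blast

end

section \<open>Partitions in a box and the involution\<close>

lemma Pnk_iff:
  assumes "1 \<le> n"
  shows "mu \<in> Pnk n k \<longleftrightarrow> sorted_wrt (\<ge>) mu \<and> length mu = n \<and> set mu \<subseteq> {1..k}"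
proof (cases mu)
  case Nil
  then show ?thesis using assms by (auto simp: Pnk_def)
next
  case (Cons a m)
  then show ?thesis
    by (fastforce simp: Pnk_def is_partition_def)
qed

lemma Pnk_mono: "n \<le> m \<Longrightarrow> Pnk l n \<subseteq> Pnk l m"
  by (auto simp: Pnk_def)

lemma snoc_Pnk:
  assumes "1 \<le> n"
  shows "mu @ [j] \<in> Pnk (Suc n) k \<longleftrightarrow> mu \<in> Pnk n k \<and> 1 \<le> j \<and> j \<le> last mu"
proof -
  have "(\<forall>x\<in>set mu. j \<le> x) \<longleftrightarrow> j \<le> last mu" if sorted: "sorted_wrt (\<ge>) mu" and len: "length mu = n"
  proof -
    obtain m a where "mu = m @ [a]"
      using len assms by (cases mu rule: rev_cases) auto
    then show ?thesis using sorted by (fastforce simp: sorted_wrt_append)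
  qed
  moreover have "last mu \<le> k" if "set mu \<subseteq> {1..k}" "length mu = n"
    using that assms last_in_set[of mu] by (cases mu) auto
  ultimately show ?thesis
    using assms by (auto simp: Pnk_iff sorted_wrt_append)
qed

lemma length_tau [simp]: "length (tau k mu) = length mu"
  by (simp add: tau_def)

lemma tau_Pnk:
  assumes "1 \<le> n" "mu \<in> Pnk n k"
  shows "tau k mu \<in> Pnk n k"
proof -
  have "sorted_wrt (\<lambda>x y. y \<le> x) mu" "set mu \<subseteq> {1..k}" "length mu = n"
    using assms by (auto simp: Pnk_iff)
  moreover from this have "sorted_wrt (\<lambda>x y. k + 1 - y \<le> k + 1 - x) (rev mu)"
    unfolding sorted_wrt_rev
    by (elim sorted_wrt_mono_rel[rotated]) auto
  moreover have "(\<lambda>x. k + 1 - x) ` {1..k} \<subseteq> {1..k}"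
    by auto
  ultimately show ?thesis
    by (auto simp: Pnk_iff[OF assms(1)] tau_def sorted_wrt_map)
qed

lemma tau_tau:
  assumes "1 \<le> n" "mu \<in> Pnk n k"
  shows "tau k (tau k mu) = mu"
proof -
  have "set mu \<subseteq> {1..k}"
    using assms by (simp add: Pnk_iff)
  then show ?thesis
    by (auto simp: tau_def rev_map intro!: map_idI)
qed

lemma hd_tau: "mu \<noteq> [] \<Longrightarrow> hd (tau k mu) = k + 1 - last mu"
  by (cases mu rule: rev_cases) (auto simp: tau_def)

lemma last_tau: "mu \<noteq> [] \<Longrightarrow> last (tau k mu) = k + 1 - hd mu"
  by (cases mu) (auto simp: tau_def)

text \<open>In terms of Young diagrams, the first row and the first column are removed, but a part 1 outside
  the first row leaves a part 0 behind.\<close>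

definition drop_hook :: "nat list \<Rightarrow> nat list" where
  "drop_hook mu = map (\<lambda>x. x - 1) (tl mu)"

lemma drop_hook_tau: "drop_hook (tau (Suc l) mu) = tau l (butlast mu)"
proof -
  have "tl (rev mu) = rev (butlast mu)"
    by (cases mu rule: rev_cases) auto
  then show ?thesis
    by (simp add: drop_hook_def tau_def map_tl[symmetric])
qed

lemma butlast_tau:
  assumes "0 \<notin> set mu"
  shows "butlast (tau (Suc l) mu) = tau l (drop_hook mu)"
proof (cases mu)
  case (Cons a m)
  have "Suc (Suc l) - x = Suc l - (x - 1)" if "x \<in> set m" for x
  proof -
    have "x \<noteq> 0" using that assms Cons by (metis list.set_intros(2))
    then show ?thesis by simp
  qed
  then show ?thesis
    using Cons by (auto simp: drop_hook_def tau_def rev_map butlast_append)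
qed (simp add: drop_hook_def tau_def)

section \<open>Descent from one level to the previous one\<close>

lemma Plam_subset:
  assumes "1 \<le> k" "lam \<in> Pk k" "tau k lam = lam" "k \<le> l"
  shows "Plam k lam l \<subseteq> Pk l"
proof (cases "l = k")
  case True
  then show ?thesis using assms Plam_initial by auto
next
  case False
  then have "Plam k lam l = Pd k lam l \<union> Ptau k lam l"
    using assms Plam_step by simp
  then show ?thesis
    using assms tau_Pnk[of l _ l] by (auto simp: Pd_def Ptau_def extend_def)
qed

lemma tau_Plam:
  assumes "1 \<le> k" "lam \<in> Pk k" "tau k lam = lam" "k \<le> l" "mu \<in> Plam k lam l"
  shows "tau l mu \<in> Plam k lam l"
proof (cases "l = k")
  case True
  then show ?thesis using assms Plam_initial by auto
next
  case False
  then have l: "Plam k lam l = Pd k lam l \<union> Ptau k lam l"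
    using assms Plam_step by simp
  have "tau l (tau l nu) = nu" if "nu \<in> Pd k lam l" for nu
    using that assms tau_tau[of l nu l] by (auto simp: Pd_def extend_def)
  then show ?thesis
    using assms(5) unfolding l Ptau_def by auto
qed

lemma Pd_Suc:
  assumes "1 \<le> k" "lam \<in> Pk k" "tau k lam = lam" "k \<le> l"
  shows "Pd k lam (Suc l) = {mu @ [j] | mu j. mu \<in> Plam k lam l \<and> 1 \<le> j \<and> j \<le> last mu}"
proof -
  have "nu \<in> Pd k lam (Suc l) \<longleftrightarrow>
      (\<exists>mu j. nu = mu @ [j] \<and> mu \<in> Plam k lam l \<and> 1 \<le> j \<and> j \<le> last mu)" for nu
  proof (cases nu rule: rev_cases)
    case Nil
    then show ?thesis by (simp add: Pd_def extend_def Pnk_def)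
  next
    case (snoc mu j)
    have "mu \<in> Pnk l (Suc l)" if "mu \<in> Plam k lam l"
      using that Plam_subset[OF assms] Pnk_mono[of l "Suc l" l] by auto
    then show ?thesis
      using snoc assms by (auto simp: Pd_def extend_def snoc_Pnk)
  qed
  then show ?thesis by blast
qed

text \<open>Deletion of the first row and column commutes with appending a part, apart from lowering
  that part by 1, and \<open>drop_hook_tau\<close> turns it into deletion of the last part. So both ways of
  passing from level \<open>l\<close> to level \<open>l + 1\<close> preserve the claim.\<close>

lemma drop_hook_Plam:
  assumes "1 \<le> k" "lam \<in> Psq k" "tau k lam = lam" "k \<le> l"
    and "mu \<in> Plam k lam l" "2 \<le> last mu"
  shows "k < l \<and> drop_hook mu \<in> Plam k lam (l - 1)"
  using \<open>k \<le> l\<close> assms(5,6)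
proof (induction l arbitrary: mu rule: dec_induct)
  case base
  then show ?case
    using assms by (auto simp: Plam_initial Psq_def)
next
  case (step l)
  have lam: "lam \<in> Pk k"
    using assms by (simp add: Psq_def)
  note facts = assms(1) lam assms(3) step.hyps(1)
  have "drop_hook mu \<in> Plam k lam l"
  proof (cases "mu \<in> Pd k lam (Suc l)")
    case True
    then obtain rho j where mu: "mu = rho @ [j]"
      and rho: "rho \<in> Plam k lam l" "1 \<le> j" "j \<le> last rho"
      using Pd_Suc[OF facts] by auto
    then have j: "2 \<le> j"
      using step.prems by simp
    then have IH: "k < l" "drop_hook rho \<in> Plam k lam (l - 1)"
      using step.IH rho by auto
    obtain m where l: "l = Suc m" "k \<le> m"
      using IH(1) by (cases l) auto
    have rhoP: "rho \<in> Pnk l l"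
      using rho Plam_subset[OF facts] by auto
    then have "length rho = Suc m" and pos: "m \<ge> 1"
      using l assms(1) by (auto simp: Pnk_def)
    then have tl: "tl rho \<noteq> []" "rho \<noteq> []"
      by (cases rho, auto)+
    then have "last (drop_hook rho) = last rho - 1"
      by (simp add: drop_hook_def last_map last_tl)
    then have "drop_hook rho @ [j - 1] \<in> Pd k lam l"
      using IH(2) j rho(3) Pd_Suc[OF assms(1) lam assms(3) l(2)] l(1) by auto
    then show ?thesis
      using mu tl IH(1) by (simp add: drop_hook_def Plam_step)
  next
    case False
    then obtain rho where "mu = tau (Suc l) rho" "rho \<in> Pd k lam (Suc l)"
      using step.hyps(1) step.prems(1)
      by (auto simp: Ptau_def Plam_step simp del: Plam.simps)
    then show ?thesis
      using Pd_Suc[OF facts] tau_Plam[OF facts] by (auto simp: drop_hook_tau)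
  qed
  then show ?case
    using step.hyps by simp
qed

text \<open>By \<open>drop_hook_Plam\<close>, \<open>\<tau>(\<mu> : j)\<close> with \<open>j \<ge> 2\<close> has the form \<open>(\<rho> : i)\<close> for some \<open>\<rho>\<close> of the
  previous level, so that only \<open>j = 1\<close> contributes to \<open>\<P>\<^sub>\<tau> - \<P>\<^sub>d\<close>.\<close>

lemma tau_Pd:
  assumes "1 \<le> k" "lam \<in> Psq k" "tau k lam = lam" "k \<le> l"
    and "mu \<in> Plam k lam l" "2 \<le> j" "j \<le> last mu"
  shows "tau (Suc l) (mu @ [j]) \<in> Pd k lam (Suc l)"
proof -
  have lam: "lam \<in> Pk k"
    using assms by (simp add: Psq_def)
  have nu: "mu @ [j] \<in> Pd k lam (Suc l)"
    using assms Pd_Suc[OF assms(1) lam assms(3,4)] by auto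
  then have P: "mu @ [j] \<in> Pk (Suc l)" and "mu @ [j] \<in> Plam k lam (Suc l)"
    using assms(4) by (auto simp: Pd_def extend_def Plam_step)
  then have "drop_hook (mu @ [j]) \<in> Plam k lam l"
    using drop_hook_Plam[OF assms(1-3), of "Suc l" "mu @ [j]"] assms(4,6) by auto
  then have "tau l (drop_hook (mu @ [j])) \<in> Plam k lam l"
    using tau_Plam[OF assms(1) lam assms(3,4)] by blast
  moreover have "0 \<notin> set (mu @ [j])"
    using P by (auto simp: Pnk_def is_partition_def)
  ultimately have "butlast (tau (Suc l) (mu @ [j])) \<in> Plam k lam l"
    using butlast_tau[of "mu @ [j]" l] by (simp del: butlast_snoc)
  then show ?thesis
    using tau_Pnk[OF _ P] by (simp add: Pd_def extend_def)
qed

lemma Plam_Suc: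
  assumes "1 \<le> k" "lam \<in> Psq k" "tau k lam = lam" "k \<le> l"
  shows "Plam k lam (Suc l) = (\<Union>mu\<in>Plam k lam l. dset mu)"
proof -
  have lam: "lam \<in> Pk k"
    using assms by (simp add: Psq_def)
  note Pd = Pd_Suc[OF assms(1) lam assms(3,4)]
  have step: "Plam k lam (Suc l) = Pd k lam (Suc l) \<union> Ptau k lam (Suc l)"
    using assms by (simp add: Plam_step del: Plam.simps)
  have props: "length mu = l" "1 \<le> last mu" if "mu \<in> Plam k lam l" for mu
  proof -
    have "mu \<in> Pnk l l" using that Plam_subset[OF assms(1) lam assms(3,4)] by auto
    then have mu: "length mu = l" "set mu \<subseteq> {1..l}"
      using assms(1,4) by (auto simp: Pnk_iff)
    then have "last mu \<in> set mu"
      using assms(1,4) by (intro last_in_set) auto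
    then show "length mu = l" "1 \<le> last mu"
      using mu by auto
  qed
  have new: "nu \<in> Pd k lam (Suc l) \<or> (\<exists>mu\<in>Plam k lam l. nu = tau (Suc l) (mu @ [1]))"
    if tau: "nu \<in> Ptau k lam (Suc l)" for nu
  proof -
    obtain mu j where nu: "nu = tau (Suc l) (mu @ [j])"
      and mu: "mu \<in> Plam k lam l" "1 \<le> j" "j \<le> last mu"
      using tau Pd by (auto simp: Ptau_def)
    show ?thesis
    proof (cases "j = 1")
      case True
      then show ?thesis using nu mu by auto
    next
      case False
      then show ?thesis
        using nu mu tau_Pd[OF assms, of mu j] by simp
    qed
  qed
  have old: "tau (Suc l) (mu @ [1]) \<in> Ptau k lam (Suc l)" if "mu \<in> Plam k lam l" for mu
    using that props(2)[OF that] Pd by (auto simp: Ptau_def)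
  show ?thesis
  proof
    show "Plam k lam (Suc l) \<subseteq> (\<Union>mu\<in>Plam k lam l. dset mu)"
    proof
      fix nu assume "nu \<in> Plam k lam (Suc l)"
      then consider "nu \<in> Pd k lam (Suc l)"
        | mu where "mu \<in> Plam k lam l" "nu = tau (Suc l) (mu @ [1])"
        using new unfolding step by blast
      then show "nu \<in> (\<Union>mu\<in>Plam k lam l. dset mu)"
      proof cases
        case 1
        then show ?thesis unfolding Pd dset_def by blast
      next
        case 2
        then show ?thesis using props(1)[OF 2(1)] by (auto simp: dset_def intro!: bexI)
      qed
    qed
    show "(\<Union>mu\<in>Plam k lam l. dset mu) \<subseteq> Plam k lam (Suc l)"
    proof (rule UN_least)
      fix mu assume mu: "mu \<in> Plam k lam l"
      then show "dset mu \<subseteq> Plam k lam (Suc l)"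
        using old[OF mu] unfolding step Pd dset_def by (auto simp: props(1)[OF mu])
    qed
  qed
qed

section \<open>Children and labels in the tree of partitions\<close>

text \<open>The order is that of \<open>descendant_labels\<close>, whose intervals consist of integers.\<close>

definition children :: "nat list \<Rightarrow> nat list list" where
  "children mu = map (\<lambda>j. mu @ [nat j]) [1..int (last mu)] @ [tau (length mu + 1) (mu @ [1])]"

text \<open>The condition \<open>hd nu < length nu\<close> separates \<open>\<P>\<^sub>d\<close> from the rest of \<open>\<P>\<^sub>\<tau>\<close> above level \<open>k\<close>; at
  level \<open>k\<close> the root, with first part \<open>k\<close>, carries a pair.\<close>

definition part_label :: "nat \<Rightarrow> nat list \<Rightarrow> label" where
  "part_label k nu =
     (if length nu = k \<or> hd nu < length nu
      then PairLabel (int (last nu) + 1) (int (length nu) + 2 - int (hd nu))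
      else SingleLabel (int (last nu) + 1))"

lemma set_children: "set (children mu) = dset mu"
proof -
  have "(\<lambda>j. mu @ [nat j]) ` {1..int (last mu)} = {mu @ [j] | j. 1 \<le> j \<and> j \<le> last mu}"
  proof
    show "(\<lambda>j. mu @ [nat j]) ` {1..int (last mu)} \<subseteq> {mu @ [j] | j. 1 \<le> j \<and> j \<le> last mu}"
      by auto
    show "{mu @ [j] | j. 1 \<le> j \<and> j \<le> last mu} \<subseteq> (\<lambda>j. mu @ [nat j]) ` {1..int (last mu)}"
    proof clarify
      fix j assume "1 \<le> j" "j \<le> last mu"
      then show "mu @ [j] \<in> (\<lambda>j. mu @ [nat j]) ` {1..int (last mu)}"
        by (intro image_eqI[of _ _ "int j"]) auto
    qed
  qed
  then show ?thesis by (auto simp: children_def dset_def)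
qed

lemma hd_children:
  assumes "1 \<le> l" "mu \<in> Pk l"
  shows "hd (mu @ [j]) \<le> l" "hd (tau (Suc l) (mu @ [1])) = Suc l"
  using assms by (auto simp: Pnk_def hd_append hd_tau)

lemma distinct_children:
  assumes "1 \<le> l" "mu \<in> Pk l"
  shows "distinct (children mu)"
proof -
  have "length mu = l"
    using assms by (simp add: Pnk_def)
  moreover have "tau (Suc l) (mu @ [1]) \<noteq> mu @ [j]" for j
    using hd_children[OF assms] by (metis Suc_n_not_le_n)
  ultimately show ?thesis
    by (auto simp: children_def distinct_map inj_on_def)
qed

lemma dset_parent_unique:
  assumes "1 \<le> l" "mu \<in> Pk l" "1 \<le> l'" "mu' \<in> Pk l'" "nu \<in> dset mu" "nu \<in> dset mu'"
  shows "mu = mu'"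
proof -
  have len: "length mu = l" "length mu' = l'"
    using assms by (auto simp: Pnk_def)
  have "length nu = Suc l"
    using assms(5) len by (auto simp: dset_def)
  moreover have "length nu = Suc l'"
    using assms(6) len by (auto simp: dset_def)
  ultimately have l': "l' = l" by simp
  note mu' = assms(4)[unfolded l']
  have last: "1 \<le> last m" if "m \<in> Pk l" for m
    using that assms(1) last_in_set[of m] by (fastforce simp: Pnk_def is_partition_def)
  have P: "m @ [1] \<in> Pnk (Suc l) (Suc l)" if "m \<in> Pk l" for m
    using that last[OF that] Pnk_mono[of l "Suc l" l] snoc_Pnk[OF assms(1)] by auto
  have inj: "m = m'" if "m \<in> Pk l" "m' \<in> Pk l" "tau (Suc l) (m @ [1]) = tau (Suc l) (m' @ [1])"
    for m m'
  proof -
    have "m @ [1] = m' @ [1]"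
      using that P tau_tau[of "Suc l" _ "Suc l"] by (metis le_add1 plus_1_eq_Suc)
    then show ?thesis by simp
  qed
  have cases: "(\<exists>j. nu = m @ [j] \<and> hd nu \<le> l) \<or> (nu = tau (Suc l) (m @ [1]) \<and> hd nu = Suc l)"
    if "m \<in> Pk l" "nu \<in> dset m" for m
  proof -
    have "length m = l" using that(1) by (simp add: Pnk_def)
    then show ?thesis
      using that(2) hd_children[OF assms(1) that(1)] by (auto simp: dset_def)
  qed
  show ?thesis
    using cases[OF assms(2,5)] cases[OF mu' assms(6)] inj[OF assms(2) mu'] by auto
qed

text \<open>If the label of \<open>mu\<close> is a single integer, then the first part of \<open>mu\<close> is \<open>length mu\<close>, and
  the entry 3 in the labels of its descendants is \<open>length mu + 3 - hd mu\<close>.\<close>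

lemma part_label_children:
  assumes "1 \<le> k" "k \<le> l" "mu \<in> Pk l"
  shows "map (part_label k) (children mu) = descendant_labels (part_label k mu)"
proof -
  have len: "length mu = l" and hd: "hd mu \<le> l" and ne: "mu \<noteq> []"
    using assms by (auto simp: Pnk_def)
  have l: "1 \<le> l" using assms by simp
  have snoc: "part_label k (mu @ [nat j]) = PairLabel (j + 1) (int l + 3 - int (hd mu))"
    if "1 \<le> j" for j
    using that len hd ne by (auto simp: part_label_def)
  have tau: "part_label k (tau (Suc l) (mu @ [1])) = SingleLabel (int l + 3 - int (hd mu))"
    using len hd ne assms(2) hd_children(2)[OF l assms(3)]
    by (auto simp: part_label_def last_tau)
  have shift: "[2..i + 1] = map (\<lambda>j. j + 1) [1..i]" for i :: int
    by (intro nth_equalityI) (auto simp: nth_upto)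
  have "map (part_label k) (map (\<lambda>j. mu @ [nat j]) [1..int (last mu)]) =
      map (\<lambda>p. PairLabel p (int l + 3 - int (hd mu))) [2..int (last mu) + 1]"
    unfolding shift map_map by (intro map_cong refl) (use snoc in auto)
  then have "map (part_label k) (children mu) =
      map (\<lambda>p. PairLabel p (int l + 3 - int (hd mu))) [2..int (last mu) + 1] @
        [SingleLabel (int l + 3 - int (hd mu))]"
    using tau len unfolding children_def map_append by simp
  also have "\<dots> = descendant_labels (part_label k mu)"
  proof (cases "length mu = k \<or> hd mu < length mu")
    case True
    then have "part_label k mu = PairLabel (int (last mu) + 1) (int l + 2 - int (hd mu))"
      by (simp add: part_label_def len)
    then show ?thesis by (simp add: algebra_simps)
  next
    case False
    then have "part_label k mu = SingleLabel (int (last mu) + 1)" "hd mu = l"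
      using len hd by (auto simp: part_label_def)
    then show ?thesis by simp
  qed
  finally show ?thesis .
qed

section \<open>The isomorphism\<close>

theorem mainTheorem3:
  fixes k :: nat and lam :: "nat list"
  assumes "k \<ge> 1"
    and "lam \<in> Psq k"
    and "tau k lam = lam"
  shows "\<exists>\<psi>. graph_iso (Tlam_verts k lam) Tlam_adj T_verts T_adj \<psi> \<and>
           \<psi> lam = T_root \<and>
           (\<forall>l\<ge>k. \<forall>nu\<in>Plam k lam l.
              (nu \<in> Pd k lam l \<longrightarrow>
                 T_label (\<psi> nu) = PairLabel (int (last nu) + 1) (int l + 2 - int (hd nu))) \<and>
              (nu \<in> Ptau k lam l - Pd k lam l \<longrightarrow>
                 T_label (\<psi> nu) = SingleLabel (int (last nu) + 1)))"
proof -
  define V where "V = Tlam_verts k lam"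
  define f where "f = node children lam"
  define \<psi> where "\<psi> = inv_into T_verts f"
  have lam: "lam \<in> Pk k" "length lam = k" "hd lam = k" "last lam = 1"
    using assms(2) by (auto simp: Psq_def Pnk_def)
  have PlamP: "mu \<in> Pk l" if "k \<le> l" "mu \<in> Plam k lam l" for mu l
    using that Plam_subset[OF assms(1) lam(1) assms(3)] by blast
  have V: "\<exists>l\<ge>k. 1 \<le> l \<and> mu \<in> Plam k lam l \<and> mu \<in> Pk l \<and> length mu = l"
    if in_V: "mu \<in> V" for mu
  proof -
    obtain l where l: "k \<le> l" "mu \<in> Plam k lam l"
      using in_V by (auto simp: V_def Tlam_verts_def)
    then have "mu \<in> Pk l" by (rule PlamP)
    then show ?thesis using l assms(1) by (auto simp: Pnk_def)
  qed
  have root: "lam \<in> V"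
    using assms(1) Plam_initial[of k lam] by (auto simp: V_def Tlam_verts_def)
  have root_label: "part_label k lam = PairLabel 2 2"
    using lam by (simp add: part_label_def)
  have labels: "map (part_label k) (children mu) = descendant_labels (part_label k mu)"
    if "mu \<in> V" for mu
    using V[OF that] part_label_children[OF assms(1)] by blast
  have closed: "set (children mu) \<subseteq> V" if in_V: "mu \<in> V" for mu
  proof -
    obtain l where "k \<le> l" "mu \<in> Plam k lam l"
      using V[OF in_V] by blast
    then have "dset mu \<subseteq> Plam k lam (Suc l)" "Suc l \<in> {k..}"
      using Plam_Suc[OF assms] by auto
    then show ?thesis
      unfolding V_def Tlam_verts_def set_children by blast
  qed
  have dist: "distinct (children mu)" if "mu \<in> V" for mu
    using V[OF that] distinct_children by blast
  have length_child: "length nu = Suc (length mu)" if "nu \<in> set (children mu)" for mu nu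
    using that by (auto simp: set_children dset_def)
  have not_child: "lam \<notin> set (children mu)" if "mu \<in> V" for mu
    using V[OF that] length_child lam(2) by fastforce
  have parent: "mu = mu'"
    if "mu \<in> V" "mu' \<in> V" "nu \<in> set (children mu)" "nu \<in> set (children mu')" for mu mu' nu
    using V[OF that(1)] V[OF that(2)] that(3,4) dset_parent_unique[of _ mu _ mu' nu]
    by (auto simp: set_children)
  have reach: "\<exists>mu\<in>V. nu \<in> set (children mu) \<and> length mu < length nu"
    if in_V: "nu \<in> V" and ne: "nu \<noteq> lam" for nu
  proof -
    obtain l where l: "k \<le> l" "nu \<in> Plam k lam l"
      using V[OF in_V] by blast
    moreover have "l \<noteq> k"
      using l(2) ne assms(1,3) Plam_initial by auto
    ultimately obtain m where m: "l = Suc m" "k \<le> m"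
      by (cases l) auto
    then obtain mu where mu: "mu \<in> Plam k lam m" "nu \<in> dset mu"
      using l Plam_Suc[OF assms m(2)] by auto
    moreover have "mu \<in> V"
      using mu(1) m(2) by (auto simp: V_def Tlam_verts_def)
    ultimately show ?thesis
      using length_child[of nu mu] by (auto simp: set_children)
  qed
  interpret generated_tree lam V "part_label k" children length
    by standard (fact root root_label labels closed dist not_child parent reach)+
  have bij: "bij_betw f T_verts V"
    unfolding f_def by (rule node_bij)
  have \<psi>: "\<psi> nu \<in> T_verts" "f (\<psi> nu) = nu" if "nu \<in> V" for nu
    using bij that unfolding \<psi>_def
    by (auto simp: bij_betw_def inv_into_into f_inv_into_f)
  have label: "T_label (\<psi> nu) = part_label k nu" if "nu \<in> V" for nu
    using T_label_node[OF \<psi>(1)[OF that]] \<psi>(2)[OF that]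
    by (simp add: f_def)
  have "graph_iso V Tlam_adj T_verts T_adj \<psi>"
    unfolding graph_iso_def
  proof (intro conjI ballI)
    show "bij_betw \<psi> V T_verts"
      unfolding \<psi>_def by (rule bij_betw_inv_into[OF bij])
    show "Tlam_adj mu nu = T_adj (\<psi> mu) (\<psi> nu)" if "mu \<in> V" "nu \<in> V" for mu nu
      using T_adj_node[OF \<psi>(1)[OF that(1)] \<psi>(1)[OF that(2)]]
        \<psi>(2)[OF that(1)] \<psi>(2)[OF that(2)]
      by (simp add: Tlam_adj_def set_children f_def)
  qed
  moreover have "\<psi> lam = T_root"
    unfolding \<psi>_def using bij T_verts.root
    by (intro inv_into_f_eq) (auto simp: bij_betw_def f_def)
  moreover have "(nu \<in> Pd k lam l \<longrightarrow>
        T_label (\<psi> nu) = PairLabel (int (last nu) + 1) (int l + 2 - int (hd nu))) \<and>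
      (nu \<in> Ptau k lam l - Pd k lam l \<longrightarrow> T_label (\<psi> nu) = SingleLabel (int (last nu) + 1))"
    if l: "k \<le> l" and nu: "nu \<in> Plam k lam l" for l nu
  proof (cases "l = k")
    case True
    then show ?thesis
      using Pd_Ptau_initial[OF assms(1), of lam] by simp
  next
    case False
    then obtain m where m: "l = Suc m" "k \<le> m"
      using l by (cases l) auto
    have "nu \<in> V"
      using l nu by (auto simp: V_def Tlam_verts_def)
    note eq = label[OF this]
    obtain mu where mu: "mu \<in> Plam k lam m" "nu \<in> dset mu"
      using nu m Plam_Suc[OF assms m(2)] by auto
    have muP: "mu \<in> Pk m" "length mu = m" and m1: "1 \<le> m"
      using PlamP[OF m(2) mu(1)] m(2) assms(1) by (auto simp: Pnk_def)
    note Pd = Pd_Suc[OF assms(1) lam(1) assms(3) m(2), folded m(1)]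
    have len: "length nu = l"
      using mu(2) muP(2) m(1) by (auto simp: dset_def)
    have Pd_hd: "hd nu < l" if in_Pd: "nu \<in> Pd k lam l"
    proof -
      obtain rho j where "nu = rho @ [j]" "rho \<in> Plam k lam m"
        using in_Pd Pd by auto
      then show ?thesis
        using hd_children(1)[OF m1 PlamP[OF m(2)]] m(1) by (simp add: less_Suc_eq_le)
    qed
    have not_Pd_hd: "hd nu = l" if "nu \<notin> Pd k lam l"
      using that mu Pd hd_children(2)[OF m1 muP(1)] m(1) muP(2) by (auto simp: dset_def)
    show ?thesis
      using eq len False Pd_hd not_Pd_hd by (auto simp: part_label_def)
  qed
  ultimately show ?thesis
    unfolding V_def by blast
qed

end
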